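(* Let $Eq_\infty$ be the countable equality function on $2^\omega$, given (identifying elements of $2^\omega=\{0,1\}^{\mathbb{N}}$ with subsets of $\mathbb{N}$) by $Eq_\infty(A,B)=\{n\mid\forall m\,([n,m]\in A\Leftrightarrow[n,m]\in B)\}$, regarded as a function $2^\omega\to2^\omega$ on coded pairs. (a) The set $2^\omega$ cannot be written as a countable union $\bigcup_{i\in\mathbb{N}}V_i$ such that $Eq_\infty$ is Cantor continuous on each $V_i$ (i.e. each restriction of $Eq_\infty$ to $V_i$ with the subspace topology is continuous for the Cantor topology). (b) The function $Eq_\infty$ is, relative to the pca $2^\omega$, not computable in any function $F:2^\omega\to2^\omega$ with countable image; i.e. for every such $F$, $Eq_\infty$ is not representable in $2^\omega[F]$.
   Context: A partial combinatory algebra (pca) is a set $\mathcal{A}$ with a partial binary application $(a,b)\mapsto ab$ (associating to the left) such that there are $\mathsf{k},\mathsf{s}\in\mathcal{A}$ with, for all $a,b,c$: $\mathsf{k}ab=a$; $\mathsf{s}ab$ is defined; and whenever $(ac)(bc)$ is defined, $\mathsf{s}abc$ is defined and equals $(ac)(bc)$. A partial function $f:\mathcal{A}\to\mathcal{A}$ is representable in $\mathcal{A}$ if there is $a_f\in\mathcal{A}$ with $a_fa=f(a)$ for all $a$ in the domain of $f$. Every pca contains booleans $\mathsf{T},\mathsf{F}$ with a definition-by-cases element $D$ ($D\mathsf{T}ab=a$, $D\mathsf{F}ab=b$), and standard codings $[a,b]$ of pairs and $[a_0,\ldots,a_{n-1}]$ of finite sequences whose basic operations (length, projections, appending) are representable;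 fix such choices. For a pca $\mathcal{A}$ and a partial function $f:\mathcal{A}\to\mathcal{A}$, $\mathcal{A}[f]$ is the pca with underlying set $\mathcal{A}$ and application $\cdot_f$ defined by: $a\cdot_f b=c$ iff there is a finite sequence $e_0,\ldots,e_{n-1}$ in $\mathcal{A}$ (on each of which $f$ is defined) such that $a[b,f(e_0),\ldots,f(e_{i-1})]=[\mathsf{F},e_i]$ for all $i<n$ and $a[b,f(e_0),\ldots,f(e_{n-1})]=[\mathsf{T},c]$. The pca $2^\omega$: underlying set $\{0,1\}^{\mathbb{N}}$; $\alpha\cdot\beta$ is defined iff for every $n$ there is $k$ with $\alpha([n,\beta(0),\ldots,\beta(k-1)])=1$ (with $[\cdot,\ldots,\cdot]$ a standard coding of finite sequences of naturals by naturals), and then $(\alpha\cdot\beta)(n)=\alpha([n,\beta(0),\ldots,\beta(k)])$ for the least such $k$. Elements $\alpha$ of $2^\omega$ are identified with subsets $\{n\mid\alpha(n)=1\}$ of $\mathbb{N}$; $[\cdot,\cdot]$ on $\mathbb{N}$ is a standard bijective pairing. The pairing on $2^\omega$ may be taken to be the homeomorphism $(A,B)\mapsto\{2n\mid n\in A\}\cup\{2n+1\mid n\in B\}$. The Cantor topology on $2^\omega$ is the product topology of discrete copies of $\{0,1\}$; a partial function on $2^\omega$ is representable in the pca $2^\omega$ iff it is Cantor continuous on its domain. *)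

theory Defs
  imports "HOL-Analysis.Analysis" "HOL-Library.Nat_Bijection"
begin

section \<open>Partial combinatory algebras\<close>

text \<open>A partial binary application on \<open>'a\<close> has type \<open>'a \<Rightarrow> 'a \<Rightarrow> 'a option\<close>.  The following two
  abbreviations are the left-associated terms \<open>x a b\<close> and \<open>x a b c\<close>; an equation with right-hand
  side \<open>Some v\<close> says that the term is defined with value \<open>v\<close>.\<close>

abbreviation app2 :: "('a \<Rightarrow> 'a \<Rightarrow> 'a option) \<Rightarrow> 'a \<Rightarrow> 'a \<Rightarrow> 'a \<Rightarrow> 'a option" where
  "app2 app x a b \<equiv> Option.bind (app x a) (\<lambda>y. app y b)"

abbreviation app3 :: "('a \<Rightarrow> 'a \<Rightarrow> 'a option) \<Rightarrow> 'a \<Rightarrow> 'a \<Rightarrow> 'a \<Rightarrow> 'a \<Rightarrow> 'a option" where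
  "app3 app x a b c \<equiv> Option.bind (app2 app x a b) (\<lambda>y. app y c)"

locale pca =
  fixes app :: "'a \<Rightarrow> 'a \<Rightarrow> 'a option"
  assumes combinators: "\<exists>k s. \<forall>a b c.
      app2 app k a b = Some a \<and>
      app2 app s a b \<noteq> None \<and>
      (\<forall>v. Option.bind (app a c) (\<lambda>x. Option.bind (app b c) (\<lambda>y. app x y)) = Some v
           \<longrightarrow> app3 app s a b c = Some v)"

definition representable :: "('a \<Rightarrow> 'a \<Rightarrow> 'a option) \<Rightarrow> ('a \<Rightarrow> 'a option) \<Rightarrow> bool" where
  "representable app f \<longleftrightarrow> (\<exists>r. \<forall>a v. f a = Some v \<longrightarrow> app r a = Some v)"

text \<open>An admissible choice of booleans, pairing, numerals and coding of finite sequences.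
  Numerals occur because they are the values of the length function and the arguments of the
  projections from coded sequences.  Appending means adding one entry at the end.\<close>

locale pca_coding = pca app
  for app :: "'a \<Rightarrow> 'a \<Rightarrow> 'a option" +
  fixes tt ff :: 'a
    and pair :: "'a \<Rightarrow> 'a \<Rightarrow> 'a"
    and num :: "nat \<Rightarrow> 'a"
    and seq :: "'a list \<Rightarrow> 'a"
  assumes booleans: "\<exists>d. \<forall>a b. app3 app d tt a b = Some a \<and> app3 app d ff a b = Some b"
    and pairing: "\<exists>p. \<forall>a b. app2 app p a b = Some (pair a b)"
    and unpairing: "\<exists>p. \<forall>a b. app p (pair a b) = Some a" "\<exists>p. \<forall>a b. app p (pair a b) = Some b"
    and num_Suc: "\<exists>r. \<forall>n. app r (num n) = Some (num (Suc n))"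
    and num_zero: "\<exists>r. \<forall>n. app r (num n) = Some (if n = 0 then tt else ff)"
    and num_pred: "\<exists>r. \<forall>n. app r (num (Suc n)) = Some (num n)"
    and seq_length: "\<exists>r. \<forall>xs. app r (seq xs) = Some (num (length xs))"
    and seq_nth: "\<exists>r. \<forall>xs. \<forall>i<length xs. app2 app r (seq xs) (num i) = Some (xs ! i)"
    and seq_append: "\<exists>r. \<forall>xs x. app2 app r (seq xs) x = Some (seq (xs @ [x]))"


section \<open>Adjoining a partial function\<close>

text \<open>\<open>ys\<close> is the list of the values \<open>f(e\<^sub>0), \<dots>, f(e\<^sub>n\<^sub>-\<^sub>1)\<close> of the queries \<open>es\<close>.\<close>

definition oracle_computes ::
  "('a \<Rightarrow> 'a \<Rightarrow> 'a option) \<Rightarrow> 'a \<Rightarrow> 'a \<Rightarrow> ('a \<Rightarrow> 'a \<Rightarrow> 'a) \<Rightarrow> ('a list \<Rightarrow> 'a) \<Rightarrow> ('a \<Rightarrow> 'a option)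
    \<Rightarrow> 'a \<Rightarrow> 'a \<Rightarrow> 'a \<Rightarrow> bool" where
  "oracle_computes app tt ff pair seq f a b c \<longleftrightarrow>
     (\<exists>es ys. list_all2 (\<lambda>e y. f e = Some y) es ys \<and>
        (\<forall>i<length es. app a (seq (b # take i ys)) = Some (pair ff (es ! i))) \<and>
        app a (seq (b # ys)) = Some (pair tt c))"

text \<open>The application of \<open>\<A>[f]\<close>.  The value is unique; see \<open>oracle_app_eq_Some_iff\<close> below.\<close>

definition oracle_app ::
  "('a \<Rightarrow> 'a \<Rightarrow> 'a option) \<Rightarrow> 'a \<Rightarrow> 'a \<Rightarrow> ('a \<Rightarrow> 'a \<Rightarrow> 'a) \<Rightarrow> ('a list \<Rightarrow> 'a) \<Rightarrow> ('a \<Rightarrow> 'a option)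
    \<Rightarrow> 'a \<Rightarrow> 'a \<Rightarrow> 'a option" where
  "oracle_app app tt ff pair seq f a b =
     (if \<exists>c. oracle_computes app tt ff pair seq f a b c
      then Some (THE c. oracle_computes app tt ff pair seq f a b c) else None)"

context pca_coding
begin

lemma pair_inject: assumes "pair a b = pair a' b'" shows "a = a'" "b = b'"
  using unpairing assms by (metis option.inject)+

lemma tt_eq_ff: assumes "tt = ff" shows "(a::'a) = b"
  using booleans assms by (metis option.inject)

lemma oracle_computes_unique:
  assumes "oracle_computes app tt ff pair seq f a b c" "oracle_computes app tt ff pair seq f a b c'"
  shows "c = c'"
proof (cases "tt = ff")
  case True
  then show ?thesis by (rule tt_eq_ff)
next
  case False
  from assms obtain es ys es' ys' where
    1: "list_all2 (\<lambda>e y. f e = Some y) es ys"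
       "\<And>i. i < length es \<Longrightarrow> app a (seq (b # take i ys)) = Some (pair ff (es ! i))"
       "app a (seq (b # ys)) = Some (pair tt c)" and
    2: "list_all2 (\<lambda>e y. f e = Some y) es' ys'"
       "\<And>i. i < length es' \<Longrightarrow> app a (seq (b # take i ys')) = Some (pair ff (es' ! i))"
       "app a (seq (b # ys')) = Some (pair tt c')"
    unfolding oracle_computes_def by blast
  note len = list_all2_lengthD[OF 1(1)] list_all2_lengthD[OF 2(1)]
  have agree: "take i ys = take i ys'" if "i \<le> length es" "i \<le> length es'" for i
    using that
  proof (induction i)
    case (Suc i)
    then have eq: "take i ys = take i ys'" by simp
    have "Some (pair ff (es ! i)) = Some (pair ff (es' ! i))"
      using 1(2)[of i] 2(2)[of i] Suc.prems unfolding eq by (metis Suc_le_eq)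
    then have "es ! i = es' ! i"
      using pair_inject(2) by blast
    moreover have "f (es ! i) = Some (ys ! i)" "f (es' ! i) = Some (ys' ! i)"
      using list_all2_nthD[OF 1(1)] list_all2_nthD[OF 2(1)] Suc.prems by auto
    ultimately show ?case
      using eq Suc.prems len by (simp add: take_Suc_conv_app_nth)
  qed simp
  have "\<not> length es < length es'"
  proof
    assume less: "length es < length es'"
    then have "ys = take (length es) ys'" using agree[of "length es"] len by simp
    then have "Some (pair tt c) = Some (pair ff (es' ! length es))"
      using 1(3) 2(2)[OF less] by metis
    then show False using False pair_inject(1) by blast
  qed
  moreover have "\<not> length es' < length es"
  proof
    assume less: "length es' < length es"
    then have "take (length es') ys = ys'" using agree[of "length es'"] len by simp
    then have "Some (pair tt c') = Some (pair ff (es ! length es'))"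
      using 2(3) 1(2)[OF less] by metis
    then show False using False pair_inject(1) by blast
  qed
  ultimately have "length es = length es'"
    by simp
  then have "ys = ys'"
    using agree[of "length es"] len by (metis order_refl take_all)
  then show ?thesis
    using 1(3) 2(3) pair_inject(2) by (metis option.inject)
qed

lemma oracle_app_eq_Some_iff:
  "oracle_app app tt ff pair seq f a b = Some c \<longleftrightarrow> oracle_computes app tt ff pair seq f a b c"
proof -
  have "(THE c. oracle_computes app tt ff pair seq f a b c) = c"
    if "oracle_computes app tt ff pair seq f a b c" for c
    using that oracle_computes_unique by (intro the_equality)
  then show ?thesis
    unfolding oracle_app_def by auto
qed

end


section \<open>The pca on Cantor space\<close>

text \<open>Subsets of \<open>\<nat>\<close> are identified with their characteristic functions.  The library topology on
  \<open>nat \<Rightarrow> bool\<close> is the product of the discrete topologies on \<open>bool\<close>, i.e. the Cantor topology.\<close>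

type_synonym cantor = "nat \<Rightarrow> bool"

text \<open>The number coding the sequence \<open>n, \<beta>(0), \<dots>, \<beta>(k-1)\<close>.\<close>

definition query :: "nat \<Rightarrow> cantor \<Rightarrow> nat \<Rightarrow> nat" where
  "query n \<beta> k = list_encode (n # map (\<lambda>i. of_bool (\<beta> i)) [0..<k])"

definition cantor_app :: "cantor \<Rightarrow> cantor \<Rightarrow> cantor option" where
  "cantor_app \<alpha> \<beta> =
     (if \<forall>n. \<exists>k. \<alpha> (query n \<beta> k)
      then Some (\<lambda>n. \<alpha> (query n \<beta> (Suc (LEAST k. \<alpha> (query n \<beta> k)))))
      else None)"

definition cantor_pair :: "cantor \<Rightarrow> cantor \<Rightarrow> cantor" where
  "cantor_pair A B = (\<lambda>k. k \<in> {2 * n |n. A n} \<union> {2 * n + 1 |n. B n})"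

definition cantor_fst :: "cantor \<Rightarrow> cantor" where
  "cantor_fst C = (\<lambda>n. C (2 * n))"

definition cantor_snd :: "cantor \<Rightarrow> cantor" where
  "cantor_snd C = (\<lambda>n. C (2 * n + 1))"

lemma cantor_pair_even [simp]: "cantor_pair A B (2 * n) = A n"
  and cantor_pair_odd [simp]: "cantor_pair A B (Suc (2 * n)) = B n"
  unfolding cantor_pair_def by (auto, presburger+)

lemma cantor_fst_pair [simp]: "cantor_fst (cantor_pair A B) = A"
  and cantor_snd_pair [simp]: "cantor_snd (cantor_pair A B) = B"
  by (simp_all add: cantor_fst_def cantor_snd_def)

lemma cantor_pair_fst_snd [simp]: "cantor_pair (cantor_fst C) (cantor_snd C) = C"
proof
  fix k show "cantor_pair (cantor_fst C) (cantor_snd C) k = C k"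
    by (cases k rule: parity_cases)
      (metis cantor_fst_def cantor_pair_even dvd_mult_div_cancel,
       metis cantor_snd_def cantor_pair_odd odd_two_times_div_two_succ Suc_eq_plus1)
qed

definition eq_infty :: "cantor \<Rightarrow> cantor \<Rightarrow> cantor" where
  "eq_infty A B = (\<lambda>n. \<forall>m. A (prod_encode (n, m)) \<longleftrightarrow> B (prod_encode (n, m)))"

text \<open>The same function on coded pairs; since \<open>cantor_pair\<close> is a bijection it is total.\<close>

definition Eq_infty :: "cantor \<Rightarrow> cantor" where
  "Eq_infty C = eq_infty (cantor_fst C) (cantor_snd C)"

lemma Eq_infty_pair: "Eq_infty (cantor_pair A B) = eq_infty A B"
  by (simp add: Eq_infty_def)


section \<open>Existence of codings on Cantor space\<close>

text \<open>\<open>cantor_app\<close> is a pca, and booleans, numerals and a coding of sequences compatible with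
  \<open>cantor_pair\<close> exist, so \<open>pca_coding cantor_app tt ff cantor_pair num seq\<close> is satisfiable.
  \<open>cont1\<close> and \<open>cont2\<close> are Cantor continuity of unary and binary partial maps, given by a modulus.\<close>

definition agree :: "nat \<Rightarrow> cantor \<Rightarrow> cantor \<Rightarrow> bool" where
  "agree k x y \<longleftrightarrow> (\<forall>i<k. x i = y i)"

lemma agree_refl: "agree k x x" by (simp add: agree_def)

lemma agree_mono: "agree l x y \<Longrightarrow> k \<le> l \<Longrightarrow> agree k x y" by (simp add: agree_def)

definition cont2 :: "(cantor \<times> cantor) set \<Rightarrow> (cantor \<Rightarrow> cantor \<Rightarrow> cantor) \<Rightarrow> bool" where
  "cont2 D g \<longleftrightarrow> (\<forall>a b n. (a, b) \<in> D \<longrightarrow>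
     (\<exists>k. \<forall>a' b'. (a', b') \<in> D \<longrightarrow> agree k a a' \<longrightarrow> agree k b b' \<longrightarrow> g a' b' n = g a b n))"

definition cont1 :: "cantor set \<Rightarrow> (cantor \<Rightarrow> cantor) \<Rightarrow> bool" where
  "cont1 D f \<longleftrightarrow> (\<forall>a n. a \<in> D \<longrightarrow> (\<exists>k. \<forall>a'. a' \<in> D \<longrightarrow> agree k a a' \<longrightarrow> f a' n = f a n))"

lemma query_eqI: "agree k x y \<Longrightarrow> query n x k = query n y k"
proof -
  assume "agree k x y"
  then have "map (\<lambda>i. of_bool (x i) :: nat) [0..<k] = map (\<lambda>i. of_bool (y i)) [0..<k]"
    by (intro map_cong) (auto simp: agree_def)
  then show ?thesis by (simp only: query_def)
qed

lemma rep_param: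
  assumes g: "cont2 D g"
  obtains S where "cont1 UNIV S" "\<And>a b. (a, b) \<in> D \<Longrightarrow> cantor_app (S a) b = Some (g a b)"
proof -
  define P where "P a b n k v \<longleftrightarrow> (\<forall>a' b'. (a', b') \<in> D \<longrightarrow> agree k a a' \<longrightarrow> agree k b b' \<longrightarrow> g a' b' n = v)"
    for a b :: cantor and n k :: nat and v :: bool
  define R where "R a b n k \<longleftrightarrow> (\<exists>v. P a b n k v)" for a b n k
  define S :: "cantor \<Rightarrow> cantor" where "S a c = (case list_decode c of [] \<Rightarrow> False
     | n # u \<Rightarrow> let b = (\<lambda>i. i < length u \<and> u ! i = 1); l = length u in
         if \<exists>k<l. R a b n k then P a b n l True else R a b n l)" for a c
  have Pcong: "P a b n k v = P a' b' n k v" if "agree k a a'" "agree k b b'" for a b a' b' n k v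
  proof -
    have "agree k a c \<longleftrightarrow> agree k a' c" "agree k b c \<longleftrightarrow> agree k b' c" for c
      using that by (auto simp: agree_def)
    then show ?thesis by (simp add: P_def)
  qed
  have Rcong: "R a b n k = R a' b' n k" if "agree k a a'" "agree k b b'" for a b a' b' n k
    unfolding R_def using Pcong[OF that] by blast
  have Pmono: "P a b n k v \<Longrightarrow> k \<le> l \<Longrightarrow> P a b n l v" for a b n k l v
    unfolding P_def using agree_mono by blast
  have Sq: "S a (query n b l) = (if \<exists>k<l. R a b n k then P a b n l True else R a b n l)" for a n b l
  proof -
    let ?b = "\<lambda>i. i < l \<and> map (\<lambda>i. of_bool (b i)) [0..<l] ! i = (1::nat)"
    have ag: "agree k ?b b" if "k \<le> l" for k
      using that by (auto simp: agree_def)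
    have "R a ?b n k = R a b n k" "P a ?b n k v = P a b n k v" if "k \<le> l" for k v
      using Rcong Pcong ag[OF that] agree_refl by blast+
    then show ?thesis
      by (simp add: S_def query_def Let_def cong: conj_cong)
  qed
  show thesis
  proof
    show "cont1 UNIV S"
      unfolding cont1_def
    proof (intro allI impI)
      fix a c
      have "S a' c = S a c" if "agree (length (list_decode c)) a a'" for a'
      proof (cases "list_decode c")
        case (Cons n u)
        have "R a' b n k = R a b n k" "P a' b n k v = P a b n k v" if "k \<le> length u" for b k v
        proof -
          have "agree k a a'"
            using agree_mono \<open>agree (length (list_decode c)) a a'\<close> that Cons by simp
          then show "R a' b n k = R a b n k" "P a' b n k v = P a b n k v"
            using Rcong Pcong agree_refl by blast+
        qed
        then show ?thesis
          by (simp add: S_def Cons Let_def cong: conj_cong)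
      qed (simp add: S_def)
      then show "\<exists>k. \<forall>a'. a' \<in> UNIV \<longrightarrow> agree k a a' \<longrightarrow> S a' c = S a c" by blast
    qed
  next
    fix a b assume ab: "(a, b) \<in> D"
    have ex: "\<exists>k. R a b n k" for n
    proof -
      obtain k where "\<And>a' b'. (a', b') \<in> D \<Longrightarrow> agree k a a' \<Longrightarrow> agree k b b' \<Longrightarrow> g a' b' n = g a b n"
        using g ab unfolding cont2_def by blast
      then show ?thesis unfolding R_def P_def by blast
    qed
    define K where "K n = (LEAST k. R a b n k)" for n
    have RK: "R a b n (K n)" for n
      unfolding K_def using ex by (rule LeastI_ex)
    have notR: "\<not> R a b n k" if "k < K n" for n k
      using that not_less_Least unfolding K_def by blast
    have SK: "S a (query n b (K n))" for n
      using RK notR by (auto simp: Sq)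
    have Sless: "\<not> S a (query n b k)" if "k < K n" for n k
      using that notR by (auto simp: Sq)
    have L: "(LEAST k. S a (query n b k)) = K n" for n
      using SK Sless by (intro Least_equality) (auto simp: not_less[symmetric])
    have val: "S a (query n b (Suc (K n))) = g a b n" for n
    proof -
      obtain v where "P a b n (K n) v" using RK unfolding R_def by blast
      then have "P a b n (Suc (K n)) v" using Pmono by simp
      moreover from this have "v = g a b n" using ab agree_refl unfolding P_def by blast
      moreover have "P a b n (Suc (K n)) True \<Longrightarrow> g a b n" using ab agree_refl unfolding P_def by blast
      ultimately show ?thesis using RK by (auto simp: Sq)
    qed
    show "cantor_app (S a) b = Some (g a b)"
      unfolding cantor_app_def using SK by (auto simp: L val)
  qed
qed

lemma rep1:
  assumes "cont1 D f"
  shows "\<exists>r. \<forall>b\<in>D. cantor_app r b = Some (f b)"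
proof -
  have "cont2 (UNIV \<times> D) (\<lambda>a. f)"
    using assms unfolding cont1_def cont2_def by (metis mem_Sigma_iff)
  then obtain S where S: "cont1 UNIV S"
    "\<And>a b. (a, b) \<in> UNIV \<times> D \<Longrightarrow> cantor_app (S a) b = Some (f b)"
    using rep_param[of "UNIV \<times> D" "\<lambda>a. f"] by blast
  have "\<forall>b\<in>D. cantor_app (S undefined) b = Some (f b)"
    using S(2) by simp
  then show ?thesis by (intro exI[of _ "S undefined"])
qed

lemma rep1_family:
  assumes "cont1 UNIV f" "\<And>i. f (x i) = y i"
  shows "\<exists>r. \<forall>i. cantor_app r (x i) = Some (y i)"
proof -
  obtain r where "\<And>b. cantor_app r b = Some (f b)"
    using rep1[OF assms(1)] by blast
  then show ?thesis
    by (intro exI[of _ r]) (simp add: assms(2))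
qed

lemma rep2:
  assumes "cont2 D g"
  shows "\<exists>r. (\<forall>a. cantor_app r a \<noteq> None) \<and> (\<forall>(a, b) \<in> D. app2 cantor_app r a b = Some (g a b))"
proof -
  obtain S where S: "cont1 UNIV S" "\<And>a b. (a, b) \<in> D \<Longrightarrow> cantor_app (S a) b = Some (g a b)"
    using rep_param[OF assms] by blast
  from rep1[OF S(1)] obtain r where "\<And>a. cantor_app r a = Some (S a)" by blast
  then show ?thesis using S(2) by (intro exI[of _ r]) auto
qed

lemma agree_pair: "agree k a a' \<Longrightarrow> agree k b b' \<Longrightarrow> agree k (cantor_pair a b) (cantor_pair a' b')"
  unfolding agree_def cantor_pair_def by auto

lemma rep3:
  assumes "cont2 D g"
  shows "\<exists>r. (\<forall>a b. app2 cantor_app r a b \<noteq> None) \<and>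
    (\<forall>a b c. (cantor_pair a b, c) \<in> D \<longrightarrow> app3 cantor_app r a b c = Some (g (cantor_pair a b) c))"
proof -
  obtain S where S: "cont1 UNIV S" "\<And>a b. (a, b) \<in> D \<Longrightarrow> cantor_app (S a) b = Some (g a b)"
    using rep_param[OF assms] by blast
  have "cont2 UNIV (\<lambda>a b. S (cantor_pair a b))"
    using S(1) agree_pair unfolding cont1_def cont2_def by (metis UNIV_I)
  from rep2[OF this] obtain r where "\<And>a b. app2 cantor_app r a b = Some (S (cantor_pair a b))" by blast
  then show ?thesis using S(2) by (intro exI[of _ r]) (simp del: Option.bind_assoc)
qed

lemma cantor_app_cont:
  assumes "cantor_app \<alpha> \<beta> = Some \<gamma>"
  shows "\<exists>m. \<forall>\<alpha>' \<beta>' \<gamma>'. cantor_app \<alpha>' \<beta>' = Some \<gamma>' \<longrightarrow> agree m \<alpha> \<alpha>' \<longrightarrow> agree m \<beta> \<beta>'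
     \<longrightarrow> agree k \<gamma> \<gamma>'"
proof (induction k)
  case 0
  then show ?case by (simp add: agree_def)
next
  case (Suc k)
  then obtain m where m: "\<And>\<alpha>' \<beta>' \<gamma>'. cantor_app \<alpha>' \<beta>' = Some \<gamma>' \<Longrightarrow> agree m \<alpha> \<alpha>' \<Longrightarrow> agree m \<beta> \<beta>'
     \<Longrightarrow> agree k \<gamma> \<gamma>'" by blast
  define K where "K = (LEAST j. \<alpha> (query k \<beta> j))"
  have "\<exists>j. \<alpha> (query k \<beta> j)" and \<gamma>: "\<gamma> k = \<alpha> (query k \<beta> (Suc K))"
    using assms unfolding cantor_app_def K_def by (auto split: if_splits)
  then have K: "\<alpha> (query k \<beta> K)" and less: "\<And>j. j < K \<Longrightarrow> \<not> \<alpha> (query k \<beta> j)"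
    unfolding K_def by (auto intro: LeastI_ex dest: not_less_Least)
  define M where "M = Max (insert (m + K + 1) ((\<lambda>j. Suc (query k \<beta> j)) ` {..Suc K}))"
  have M: "m \<le> M" "Suc K \<le> M" "\<And>j. j \<le> Suc K \<Longrightarrow> query k \<beta> j < M"
  proof -
    have "m + K + 1 \<le> M" unfolding M_def by (rule Max_ge) auto
    then show "m \<le> M" "Suc K \<le> M" by auto
    fix j assume "j \<le> Suc K"
    then have "Suc (query k \<beta> j) \<le> M" unfolding M_def by (intro Max_ge) auto
    then show "query k \<beta> j < M" by simp
  qed
  have "agree (Suc k) \<gamma> \<gamma>'"
    if app: "cantor_app \<alpha>' \<beta>' = Some \<gamma>'" and ag: "agree M \<alpha> \<alpha>'" "agree M \<beta> \<beta>'" for \<alpha>' \<beta>' \<gamma>'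
  proof -
    have eq: "\<alpha>' (query k \<beta>' j) = \<alpha> (query k \<beta> j)" if "j \<le> Suc K" for j
    proof -
      have "query k \<beta>' j = query k \<beta> j"
        using query_eqI agree_mono[OF ag(2)] that M(2) by (metis le_trans)
      then show ?thesis using ag(1) M(3)[OF that] by (simp add: agree_def)
    qed
    have "(LEAST j. \<alpha>' (query k \<beta>' j)) = K"
    proof (rule Least_equality)
      show "\<alpha>' (query k \<beta>' K)" using eq[of K] K by simp
      show "K \<le> j" if "\<alpha>' (query k \<beta>' j)" for j
        using eq[of j] less[of j] that by (cases "j < K") auto
    qed
    then have "\<gamma>' k = \<gamma> k"
      using app eq[of "Suc K"] \<gamma> unfolding cantor_app_def by (auto split: if_splits)
    moreover have "agree k \<gamma> \<gamma>'"
      using m[OF app] ag M(1) agree_mono by blast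
    ultimately show ?thesis by (auto simp: agree_def less_Suc_eq)
  qed
  then show ?case by blast
qed

lemma pca_cantor: "pca cantor_app"
proof
  define D where "D = {(x, z). Option.bind (cantor_app (cantor_fst x) z)
     (\<lambda>u. Option.bind (cantor_app (cantor_snd x) z) (cantor_app u)) \<noteq> None}"
  define g where "g x z = the (Option.bind (cantor_app (cantor_fst x) z)
     (\<lambda>u. Option.bind (cantor_app (cantor_snd x) z) (cantor_app u)))" for x z
  have "cont2 D g"
    unfolding cont2_def
  proof (intro allI impI)
    fix x z n assume "(x, z) \<in> D"
    then obtain u v w where uvw: "cantor_app (cantor_fst x) z = Some u"
      "cantor_app (cantor_snd x) z = Some v" "cantor_app u v = Some w"
      by (auto simp: D_def bind_eq_Some_conv)
    obtain m where m: "\<And>u' v' w'. cantor_app u' v' = Some w' \<Longrightarrow> agree m u u' \<Longrightarrow> agree m v v'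
      \<Longrightarrow> agree (Suc n) w w'" using cantor_app_cont[OF uvw(3)] by blast
    obtain m1 where m1: "\<And>\<alpha>' z' u'. cantor_app \<alpha>' z' = Some u' \<Longrightarrow> agree m1 (cantor_fst x) \<alpha>'
      \<Longrightarrow> agree m1 z z' \<Longrightarrow> agree m u u'" using cantor_app_cont[OF uvw(1)] by blast
    obtain m2 where m2: "\<And>\<alpha>' z' u'. cantor_app \<alpha>' z' = Some u' \<Longrightarrow> agree m2 (cantor_snd x) \<alpha>'
      \<Longrightarrow> agree m2 z z' \<Longrightarrow> agree m v u'" using cantor_app_cont[OF uvw(2)] by blast
    have "g x' z' n = g x z n" if D': "(x', z') \<in> D" and ag: "agree (2 * (m1 + m2)) x x'"
      "agree (2 * (m1 + m2)) z z'" for x' z'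
    proof -
      from D' obtain u' v' w' where uvw': "cantor_app (cantor_fst x') z' = Some u'"
        "cantor_app (cantor_snd x') z' = Some v'" "cantor_app u' v' = Some w'"
        by (auto simp: D_def bind_eq_Some_conv)
      have "agree m u u'" using ag by (intro m1[OF uvw'(1)]) (auto simp: agree_def cantor_fst_def)
      moreover have "agree m v v'" using ag by (intro m2[OF uvw'(2)]) (auto simp: agree_def cantor_snd_def)
      ultimately have "agree (Suc n) w w'" by (rule m[OF uvw'(3)])
      then show ?thesis by (simp add: g_def uvw uvw' agree_def)
    qed
    then show "\<exists>k. \<forall>x' z'. (x', z') \<in> D \<longrightarrow> agree k x x' \<longrightarrow> agree k z z' \<longrightarrow> g x' z' n = g x z n"
      by blast
  qed
  from rep3[OF this] obtain s where s: "\<And>a b. app2 cantor_app s a b \<noteq> None"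
    "\<And>a b c. (cantor_pair a b, c) \<in> D \<Longrightarrow> app3 cantor_app s a b c = Some (g (cantor_pair a b) c)"
    by blast
  have "cont2 UNIV (\<lambda>a b. a)"
    unfolding cont2_def agree_def by (metis lessI)
  from rep2[OF this] obtain k where k: "\<And>a b. app2 cantor_app k a b = Some a" by blast
  show "\<exists>k s. \<forall>a b c. app2 cantor_app k a b = Some a \<and> app2 cantor_app s a b \<noteq> None \<and>
      (\<forall>v. Option.bind (cantor_app a c) (\<lambda>x. Option.bind (cantor_app b c) (\<lambda>y. cantor_app x y)) = Some v
           \<longrightarrow> app3 cantor_app s a b c = Some v)"
    by (rule exI[of _ k], rule exI[of _ s]) (use k s in \<open>auto simp: D_def g_def\<close>)
qed

lemma cont1I: assumes "\<And>a a' n. a \<in> D \<Longrightarrow> a' \<in> D \<Longrightarrow> agree (h n) a a' \<Longrightarrow> f a' n = f a n"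
  shows "cont1 D f"
  using assms unfolding cont1_def by metis

lemma cont2I: assumes "\<And>a a' b b' n. agree (h n) a a' \<Longrightarrow> agree (h n) b b' \<Longrightarrow> g a' b' n = g a b n"
  shows "cont2 D g"
  using assms unfolding cont2_def by metis

lemma pca_coding_cantor_exists: "\<exists>tt ff num seq. pca_coding cantor_app tt ff cantor_pair num seq"
proof -
  define num :: "nat \<Rightarrow> cantor" where "num n = (\<lambda>i. i < n)" for n
  define seq :: "cantor list \<Rightarrow> cantor" where "seq xs = cantor_pair (num (length xs))
    (\<lambda>i. case prod_decode i of (j, k) \<Rightarrow> j < length xs \<and> (xs ! j) k)" for xs
  have Least_num: "(LEAST j. \<not> num i j) = i" for i
    by (rule Least_equality) (auto simp: num_def)
  have "pca_coding cantor_app (\<lambda>_. True) (\<lambda>_. False) cantor_pair num seq"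
  proof (rule pca_coding.intro[OF pca_cantor], unfold_locales)
    have "cont2 UNIV (\<lambda>x b n. if cantor_fst x 0 then cantor_snd x n else b n)"
      by (rule cont2I[where h = "\<lambda>n. 2 * n + 2"]) (auto simp: agree_def cantor_fst_def cantor_snd_def)
    from rep3[OF this] obtain d where "\<And>x a b. app3 cantor_app d x a b =
      Some (\<lambda>n. if cantor_fst (cantor_pair x a) 0 then cantor_snd (cantor_pair x a) n else b n)"
      by blast
    then have "app3 cantor_app d (\<lambda>_. True) a b = Some a" "app3 cantor_app d (\<lambda>_. False) a b = Some b"
      for a b by simp_all
    then show "\<exists>d. \<forall>a b. app3 cantor_app d (\<lambda>_. True) a b = Some a \<and>
      app3 cantor_app d (\<lambda>_. False) a b = Some b" by blast
    have "cont2 UNIV cantor_pair"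
    proof (rule cont2I[where h = Suc])
      fix a a' b b' :: cantor and n assume "agree (Suc n) a a'" "agree (Suc n) b b'"
      from agree_pair[OF this] show "cantor_pair a' b' n = cantor_pair a b n" by (simp add: agree_def)
    qed
    from rep2[OF this] show "\<exists>p. \<forall>a b. app2 cantor_app p a b = Some (cantor_pair a b)" by auto
    have f: "cont1 UNIV cantor_fst"
      by (rule cont1I[where h = "\<lambda>n. 2 * n + 1"]) (auto simp: agree_def cantor_fst_def)
    show "\<exists>p. \<forall>a b. cantor_app p (cantor_pair a b) = Some a"
      using rep1[OF f] by (metis UNIV_I cantor_fst_pair)
    have "cont1 UNIV cantor_snd"
      by (rule cont1I[where h = "\<lambda>n. 2 * n + 2"]) (auto simp: agree_def cantor_snd_def)
    from rep1[OF this] show "\<exists>p. \<forall>a b. cantor_app p (cantor_pair a b) = Some b"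
      by (metis UNIV_I cantor_snd_pair)
    have "cont1 UNIV (\<lambda>m n. n = 0 \<or> m (n - 1))"
      by (rule cont1I[where h = "\<lambda>n. n + 1"]) (auto simp: agree_def)
    moreover have "num (Suc n) = (\<lambda>i. i = 0 \<or> num n (i - 1))" for n
      by (auto simp: num_def)
    ultimately show "\<exists>r. \<forall>n. cantor_app r (num n) = Some (num (Suc n))"
      by (rule rep1_family[OF _ sym])
    have "cont1 UNIV (\<lambda>m n. \<not> m 0)"
      by (rule cont1I[where h = "\<lambda>n. 1"]) (auto simp: agree_def)
    moreover have "(if n = 0 then \<lambda>_. True else (\<lambda>_. False)) = (\<lambda>i. \<not> num n 0)" for n
      by (auto simp: num_def)
    ultimately
    show "\<exists>r. \<forall>n. cantor_app r (num n) = Some (if n = 0 then \<lambda>_. True else (\<lambda>_. False))"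
      by (rule rep1_family[OF _ sym])
    have "cont1 UNIV (\<lambda>m n. m (Suc n))"
      by (rule cont1I[where h = "\<lambda>n. n + 2"]) (auto simp: agree_def)
    moreover have "num n = (\<lambda>i. num (Suc n) (Suc i))" for n
      by (auto simp: num_def)
    ultimately show "\<exists>r. \<forall>n. cantor_app r (num (Suc n)) = Some (num n)"
      by (rule rep1_family[OF _ sym])
    show "\<exists>r. \<forall>xs. cantor_app r (seq xs) = Some (num (length xs))"
      by (rule rep1_family[OF f]) (simp add: seq_def)
    define D where "D = {(s, m). (\<exists>xs. s = seq xs) \<and> (\<exists>i. m = num i)}"
    have "cont2 D (\<lambda>s m k. cantor_snd s (prod_encode (LEAST i. \<not> m i, k)))"
      unfolding cont2_def
    proof (intro allI impI)
      fix s m k assume "(s, m) \<in> D"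
      then obtain i where i: "m = num i" by (auto simp: D_def)
      let ?K = "i + 1 + 2 * prod_encode (i, k) + 2"
      have "cantor_snd s' (prod_encode (LEAST i. \<not> m' i, k)) = cantor_snd s (prod_encode (LEAST i. \<not> m i, k))"
        if D': "(s', m') \<in> D" and ag: "agree ?K s s'" "agree ?K m m'" for s' m'
      proof -
        from D' obtain i' where i': "m' = num i'" by (auto simp: D_def)
        have "num i i = num i' i" "i' < i \<Longrightarrow> num i i' = num i' i'"
          using ag(2) unfolding agree_def i i' by auto
        then have "i' = i" by (cases i i' rule: linorder_cases) (auto simp: num_def)
        then show ?thesis using ag(1) unfolding i i' by (simp add: Least_num agree_def cantor_snd_def)
      qed
      then show "\<exists>K. \<forall>s' m'. (s', m') \<in> D \<longrightarrow> agree K s s' \<longrightarrow> agree K m m' \<longrightarrow>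
        cantor_snd s' (prod_encode (LEAST i. \<not> m' i, k)) = cantor_snd s (prod_encode (LEAST i. \<not> m i, k))"
        by blast
    qed
    from rep2[OF this] obtain r where r: "\<And>s m. (s, m) \<in> D \<Longrightarrow> app2 cantor_app r s m =
      Some (\<lambda>k. cantor_snd s (prod_encode (LEAST i. \<not> m i, k)))" by blast
    have "app2 cantor_app r (seq xs) (num i) = Some (xs ! i)" if "i < length xs" for xs i
    proof -
      have "(seq xs, num i) \<in> D" by (auto simp: D_def)
      from r[OF this] show ?thesis using that by (simp add: Least_num seq_def)
    qed
    then show "\<exists>r. \<forall>xs. \<forall>i<length xs. app2 cantor_app r (seq xs) (num i) = Some (xs ! i)"
      by blast
    let ?l = "\<lambda>s j. (j = 0 \<or> cantor_fst s (j - 1)) \<and> \<not> cantor_fst s j"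
    define g where "g s x = cantor_pair (\<lambda>n. n = 0 \<or> cantor_fst s (n - 1))
      (\<lambda>i. cantor_snd s i \<or> (case prod_decode i of (j, k) \<Rightarrow> ?l s j \<and> x k))" for s x
    have "cont2 UNIV g"
    proof (rule cont2I[where h = "\<lambda>n. 4 * n + 4"])
      fix s s' x x' :: cantor and n assume ag: "agree (4 * n + 4) s s'" "agree (4 * n + 4) x x'"
      show "g s' x' n = g s x n"
      proof (cases "even n")
        case True
        then obtain m where "n = 2 * m" by (elim evenE)
        then show ?thesis using ag(1) by (simp add: g_def agree_def cantor_fst_def)
      next
        case False
        then obtain m where m: "n = Suc (2 * m)" by (elim oddE) simp
        obtain j k where jk: "prod_decode m = (j, k)" by force
        then have "m = prod_encode (j, k)" by (metis prod_decode_inverse)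
        then have "j \<le> m" "k \<le> m" using le_prod_encode_1 le_prod_encode_2 by auto
        then show ?thesis using ag m
          by (simp add: g_def jk agree_def cantor_fst_def cantor_snd_def)
      qed
    qed
    from rep2[OF this] obtain r where "\<And>s x. app2 cantor_app r s x = Some (g s x)" by blast
    moreover have "g (seq xs) x = seq (xs @ [x])" for xs x
    proof -
      have "(\<lambda>n. n = 0 \<or> num (length xs) (n - 1)) = num (Suc (length xs))"
        by (auto simp: num_def)
      moreover have "(cantor_snd (seq xs) i \<or> (case prod_decode i of (j, k) \<Rightarrow> ?l (seq xs) j \<and> x k))
         = (case prod_decode i of (j, k) \<Rightarrow> j < length (xs @ [x]) \<and> ((xs @ [x]) ! j) k)" for i
        by (cases "length xs") (auto simp: seq_def num_def nth_append less_Suc_eq split: prod.splits)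
      ultimately show ?thesis by (simp add: g_def seq_def[of "xs @ [x]"]) (simp add: seq_def)
    qed
    ultimately show "\<exists>r. \<forall>xs x. app2 cantor_app r (seq xs) x = Some (seq (xs @ [x]))"
      by (intro exI[of _ r]) simp
  qed
  then show ?thesis by blast
qed

end

theory Submission
  imports Defs
begin

text \<open>
  (a) Fix \<open>B = \<nat>\<close>, so that \<open>Eq_infty\<close> tells which columns \<open>{m. [n, m] \<in> A}\<close> of \<open>A\<close> are full, and
  build an \<open>A\<close> outside every \<open>V\<^sub>i\<close> from an increasing chain of conditions, each of which leaves
  all columns from some point on undetermined.  At stage \<open>i\<close> take an untouched column \<open>c\<close>.  If no
  extension of the condition with a full column \<open>c\<close> lies in \<open>V\<^sub>i\<close>, make column \<open>c\<close> full.
  Otherwise, take such an extension \<open>A\<close> in \<open>V\<^sub>i\<close>; by continuity, there is a finite part of \<open>A\<close> that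
  forces column \<open>c\<close> to be full within \<open>V\<^sub>i\<close>: add this finite part and put a \<open>0\<close> further on in
  column \<open>c\<close>.

  (b) A computation in \<open>2\<^sup>\<omega>[F]\<close> only depends on its argument and the finite list of oracle answers.
  For a fixed list of answers it is Cantor continuous, and there are only countably many such lists
  when the image of \<open>F\<close> is countable, so (a) applies.
\<close>

section \<open>Cantor continuity by finite moduli\<close>

lemma open_agree: "open {y. agree k x y}"
proof -
  have "open {y :: cantor. y i = x i}" for i
  proof -
    have "open ((\<lambda>y :: cantor. y i) -` {x i})"
      by (intro open_vimage open_discrete continuous_on_product_coordinates)
    then show ?thesis by (simp add: vimage_def)
  qed
  then have "open (\<Inter>i<k. {y :: cantor. y i = x i})"
    by (intro open_INT) auto
  moreover have "(\<Inter>i<k. {y :: cantor. y i = x i}) = {y. agree k x y}"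
    by (auto simp: agree_def)
  ultimately show ?thesis by simp
qed

text \<open>A basic open set of the product constrains only finitely many coordinates, so agreement
  below some \<open>k\<close> keeps a point inside it; conversely, the sets
  \<open>{y. agree k a y}\<close> are open neighbourhoods of \<open>a\<close>.\<close>

lemma continuous_on_iff_cont1: "continuous_on D f \<longleftrightarrow> cont1 D f"
proof
  assume f: "continuous_on D f"
  show "cont1 D f"
    unfolding cont1_def
  proof (intro allI impI)
    fix a n assume a: "a \<in> D"
    have "continuous_on D (\<lambda>x. f x n)"
      using continuous_on_product_then_coordinatewise[OF f] .
    then obtain U where U: "open U" "a \<in> U" "\<And>x. x \<in> D \<Longrightarrow> x \<in> U \<Longrightarrow> f x n = f a n"
      using a open_discrete[of "{f a n}"] unfolding continuous_on_topological by (metis singletonD singletonI)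
    from U(1,2) obtain X where X: "a \<in> Pi\<^sub>E UNIV X" "finite {i. X i \<noteq> UNIV}" "Pi\<^sub>E UNIV X \<subseteq> U"
      using product_topology_open_contains_basis[of "\<lambda>_. euclidean :: bool topology" UNIV U a]
      by (auto simp: open_fun_def)
    obtain k where k: "\<And>i. X i \<noteq> UNIV \<Longrightarrow> i < k"
      using X(2) unfolding finite_nat_set_iff_bounded by auto
    have "f a' n = f a n" if "a' \<in> D" "agree k a a'" for a'
    proof (rule U(3)[OF that(1)])
      have "a' i \<in> X i" for i
        using PiE_mem[OF X(1), of i] k[of i] that(2) by (cases "X i = UNIV") (simp_all add: agree_def)
      then show "a' \<in> U" using X(3) by auto
    qed
    then show "\<exists>k. \<forall>a'. a' \<in> D \<longrightarrow> agree k a a' \<longrightarrow> f a' n = f a n" by blast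
  qed
next
  assume f: "cont1 D f"
  show "continuous_on D f"
  proof (rule continuous_on_coordinatewise_then_product)
    fix n
    show "continuous_on D (\<lambda>x. f x n)"
      unfolding continuous_on_topological
    proof (intro ballI allI impI)
      fix a B assume a: "a \<in> D" and B: "open B" "f a n \<in> B"
      obtain k where "\<And>a'. a' \<in> D \<Longrightarrow> agree k a a' \<Longrightarrow> f a' n = f a n"
        using f a unfolding cont1_def by blast
      then show "\<exists>A. open A \<and> a \<in> A \<and> (\<forall>y\<in>D. y \<in> A \<longrightarrow> f y n \<in> B)"
        using B(2) by (intro exI[of _ "{y. agree k a y}"]) (auto simp: open_agree agree_refl)
    qed
  qed
qed

section \<open>Conditions and the diagonal construction for (a)\<close>

definition extends :: "cantor \<Rightarrow> (nat \<Rightarrow> bool option) \<Rightarrow> bool" where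
  "extends A p \<longleftrightarrow> p \<subseteq>\<^sub>m Some \<circ> A"

lemma extendsD: "extends A p \<Longrightarrow> p i = Some b \<Longrightarrow> A i = b"
  by (force simp: extends_def map_le_def dom_def)

lemma extends_mono: "extends A q \<Longrightarrow> p \<subseteq>\<^sub>m q \<Longrightarrow> extends A p"
  unfolding extends_def by (rule map_le_trans)

lemma chain_extension:
  assumes "\<And>i. p i \<subseteq>\<^sub>m p (Suc i)"
  obtains A where "\<And>i. extends A (p i)"
proof
  have chain: "p i \<subseteq>\<^sub>m p j" if "i \<le> j" for i j
    using that by (induction j rule: dec_induct) (auto intro: map_le_trans assms)
  \<comment> \<open>Positions that no \<open>p j\<close> decides get the value
    \<open>False\<close>.\<close>
  show "extends (\<lambda>n. \<exists>j. p j n = Some True) (p i)" for i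
    unfolding extends_def map_le_def
  proof
    fix n assume "n \<in> dom (p i)"
    then obtain b where b: "p i n = Some b" by auto
    have "b = True" if j: "p j n = Some True" for j
    proof (cases "i \<le> j")
      case True
      from chain[OF this] have "p i n = p j n" using b unfolding map_le_def by (metis domI)
      then show ?thesis using b j by simp
    next
      case False
      then have "p j \<subseteq>\<^sub>m p i" using chain by simp
      then have "p j n = p i n" using j unfolding map_le_def by (metis domI)
      then show ?thesis using b j by simp
    qed
    then have "(\<exists>j. p j n = Some True) = b" using b by (cases b) auto
    then show "p i n = (Some \<circ> (\<lambda>n. \<exists>j. p j n = Some True)) n"
      using b by simp
  qed
qed

text \<open>Conditions may have infinite domain, since a whole column can be filled in one stage;
  this weaker invariant takes the place of finiteness.\<close>

definition cofinitely_free :: "(nat \<Rightarrow> bool option) \<Rightarrow> bool" where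
  "cofinitely_free p \<longleftrightarrow> (\<exists>N. \<forall>n\<ge>N. \<forall>m. p (prod_encode (n, m)) = None)"

definition full_column :: "nat \<Rightarrow> cantor \<Rightarrow> bool" where
  "full_column c A \<longleftrightarrow> (\<forall>m. A (prod_encode (c, m)))"

text \<open>As \<open>n \<le> prod_encode (n, m)\<close>, positions below \<open>k\<close> lie in
  columns below \<open>k\<close>; so changes there and in column \<open>c\<close> affect finitely
  many columns only.\<close>

lemma cofinitely_free_modify:
  assumes "cofinitely_free p" "\<And>i. k \<le> i \<Longrightarrow> fst (prod_decode i) \<noteq> c \<Longrightarrow> q i = p i"
  shows "cofinitely_free q"
proof -
  obtain N where N: "\<And>n m. N \<le> n \<Longrightarrow> p (prod_encode (n, m)) = None"
    using assms(1) unfolding cofinitely_free_def by blast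
  have "q (prod_encode (n, m)) = None" if "n \<ge> N + k + Suc c" for n m
    using that N[of n m] assms(2)[of "prod_encode (n, m)"] le_prod_encode_1[of n m] by simp
  then show ?thesis unfolding cofinitely_free_def by blast
qed

lemma avoid_step:
  assumes p: "cofinitely_free p"
    and W: "cont1 W (\<lambda>A n. full_column n A)"
  shows "\<exists>q. cofinitely_free q \<and> p \<subseteq>\<^sub>m q \<and> (\<forall>A\<in>W. \<not> extends A q)"
proof -
  obtain c where c: "\<And>m. p (prod_encode (c, m)) = None"
    using p unfolding cofinitely_free_def by blast
  show ?thesis
  proof (cases "\<exists>A\<in>W. extends A p \<and> full_column c A")
    case False
    define q where "q i = (if fst (prod_decode i) = c then Some True else p i)" for i
    have "p i = q i" if "p i = Some b" for i b
      using c[of "snd (prod_decode i)"] that by (auto simp: q_def)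
    then have "p \<subseteq>\<^sub>m q" by (auto simp: map_le_def)
    moreover have "full_column c A" if "extends A q" for A
      using extendsD[OF that] by (simp add: full_column_def q_def)
    moreover have "cofinitely_free q"
      using p by (rule cofinitely_free_modify[where k = 0 and c = c]) (simp add: q_def)
    ultimately show ?thesis using False extends_mono by blast
  next
    case True
    then obtain A where A: "A \<in> W" "extends A p" "full_column c A" by blast
    then obtain k where k: "\<And>A'. A' \<in> W \<Longrightarrow> agree k A A' \<Longrightarrow> full_column c A'"
      using W unfolding cont1_def by metis
    \<comment> \<open>A position of column \<open>c\<close> outside the initial segment of
      \<open>A\<close> that is about to be copied.\<close>
    define z where "z = prod_encode (c, k)"
    have z: "k \<le> z" unfolding z_def by (rule le_prod_encode_2)
    \<comment> \<open>This still extends \<open>p\<close>: below \<open>k\<close> because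
      \<open>A\<close> extends \<open>p\<close>, and at \<open>z\<close> because \<open>p\<close> is
      undefined on column \<open>c\<close>.\<close>
    define q where "q i = (if i < k then Some (A i) else if i = z then Some False else p i)" for i
    have "p i = q i" if "p i = Some b" for i b
      using c[of k] that extendsD[OF A(2) that] by (auto simp: q_def z_def)
    then have "p \<subseteq>\<^sub>m q" by (auto simp: map_le_def)
    moreover have "A' \<notin> W" if "extends A' q" for A'
    proof
      assume "A' \<in> W"
      moreover have "agree k A A'"
        using extendsD[OF that] by (auto simp: agree_def q_def)
      ultimately have "full_column c A'" by (rule k)
      moreover have "\<not> A' z"
        using extendsD[OF that, of z False] z by (simp add: q_def)
      ultimately show False by (simp add: full_column_def z_def)
    qed
    moreover have "cofinitely_free q"
      using p by (rule cofinitely_free_modify[where k = "Suc z" and c = c]) (use z in \<open>simp add: q_def\<close>)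
    ultimately show ?thesis by blast
  qed
qed

lemma full_column_not_sigma_continuous:
  assumes "\<And>i. cont1 (W i) (\<lambda>A n. full_column n A)"
  shows "(\<Union>i::nat. W i) \<noteq> UNIV"
proof -
  have "\<exists>p. \<forall>i. cofinitely_free (p i) \<and> p i \<subseteq>\<^sub>m p (Suc i) \<and> (\<forall>A\<in>W i. \<not> extends A (p (Suc i)))"
  proof -
    have "cofinitely_free Map.empty" by (simp add: cofinitely_free_def)
    then show ?thesis
      using dependent_nat_choice[of "\<lambda>_. cofinitely_free"
          "\<lambda>i p q. p \<subseteq>\<^sub>m q \<and> (\<forall>A\<in>W i. \<not> extends A q)"] avoid_step[OF _ assms] by blast
  qed
  then obtain p where p: "\<And>i. p i \<subseteq>\<^sub>m p (Suc i)" "\<And>i A. A \<in> W i \<Longrightarrow> \<not> extends A (p (Suc i))"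
    by blast
  obtain A where "\<And>i. extends A (p i)" using chain_extension[where p = p] p(1) by blast
  then have "A \<notin> (\<Union>i. W i)" using p(2) by blast
  then show ?thesis by blast
qed

lemma Eq_infty_not_sigma_continuous:
  assumes "\<And>i. cont1 (V i) Eq_infty"
  shows "(\<Union>i::nat. V i) \<noteq> UNIV"
proof
  assume V: "(\<Union>i. V i) = UNIV"
  \<comment> \<open>Pairing with a fixed second component preserves agreement below
    \<open>k\<close>, so the preimages of the \<open>V i\<close> are sets of continuity for
    \<open>full_column\<close>, and they still cover the space.\<close>
  let ?g = "\<lambda>A. cantor_pair A (\<lambda>_. True)"
  have eq: "Eq_infty (?g A) n = full_column n A" for A n
    by (simp add: Eq_infty_pair eq_infty_def full_column_def)
  have "cont1 (?g -` V i) (\<lambda>A n. full_column n A)" for i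
    unfolding cont1_def
  proof (intro allI impI)
    fix A n assume "A \<in> ?g -` V i"
    then obtain k where k: "\<And>C. C \<in> V i \<Longrightarrow> agree k (?g A) C \<Longrightarrow> Eq_infty C n = Eq_infty (?g A) n"
      using assms[of i] unfolding cont1_def by (metis vimageD)
    have "full_column n A' = full_column n A" if "A' \<in> ?g -` V i" "agree k A A'" for A'
      using k[of "?g A'"] that agree_pair[OF that(2) agree_refl] by (simp add: eq)
    then show "\<exists>k. \<forall>A'. A' \<in> ?g -` V i \<longrightarrow> agree k A A' \<longrightarrow> full_column n A' = full_column n A"
      by blast
  qed
  from full_column_not_sigma_continuous[of "\<lambda>i. ?g -` V i", OF this] V show False
    by (simp flip: vimage_UN)
qed

section \<open>Continuity of oracle computations for (b)\<close>

lemma cont1_iff_agree: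
  "cont1 D f \<longleftrightarrow> (\<forall>a\<in>D. \<forall>n. \<exists>k. \<forall>a'\<in>D. agree k a a' \<longrightarrow> agree n (f a) (f a'))"
  (is "_ \<longleftrightarrow> ?R")
proof
  assume f: "cont1 D f"
  have "\<exists>k. \<forall>a'\<in>D. agree k a a' \<longrightarrow> agree n (f a) (f a')" if a: "a \<in> D" for a n
  \<comment> \<open>\<open>cont1\<close> gives a modulus for each single output position; maxima of
    these serve for a whole initial segment, the form in which \<open>cantor_app_cont\<close> takes
    its input.\<close>
  proof (induction n)
    case (Suc n)
    then obtain k where "\<And>a'. a' \<in> D \<Longrightarrow> agree k a a' \<Longrightarrow> agree n (f a) (f a')" by blast
    moreover obtain l where "\<And>a'. a' \<in> D \<Longrightarrow> agree l a a' \<Longrightarrow> f a' n = f a n"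
      using f a unfolding cont1_def by blast
    ultimately have "agree (Suc n) (f a) (f a')" if "a' \<in> D" "agree (max k l) a a'" for a'
      using that agree_mono[of "max k l" a a'] by (auto simp: agree_def less_Suc_eq)
    then show ?case by blast
  qed (simp add: agree_def)
  then show ?R by blast
next
  assume ?R
  then show "cont1 D f" unfolding cont1_def agree_def by (metis lessI)
qed

lemma cont1_comp:
  assumes "cont1 D f" "cont1 E g" "f ` D \<subseteq> E"
  shows "cont1 D (\<lambda>x. g (f x))"
  using continuous_on_compose2[of E g D f] assms by (simp add: continuous_on_iff_cont1)

lemma cont1_app:
  assumes "\<And>b. b \<in> D \<Longrightarrow> cantor_app r b = Some (f b)"
  shows "cont1 D f"
  unfolding cont1_iff_agree
proof (intro ballI allI)
  fix a n assume "a \<in> D"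
  from cantor_app_cont[OF assms[OF this]] obtain m where
    "\<And>\<alpha>' \<beta>' \<gamma>'. cantor_app \<alpha>' \<beta>' = Some \<gamma>' \<Longrightarrow> agree m r \<alpha>' \<Longrightarrow> agree m a \<beta>' \<Longrightarrow> agree n (f a) \<gamma>'"
    by blast
  then show "\<exists>k. \<forall>a'\<in>D. agree k a a' \<longrightarrow> agree n (f a) (f a')"
    using assms agree_refl by blast
qed

text \<open>The intermediate value \<open>h b\<close> varies with \<open>b\<close> and acts as the
  left factor of the second application, so this rests on the joint continuity of
  application.\<close>

lemma cont1_app2:
  assumes "\<And>b. b \<in> D \<Longrightarrow> app2 cantor_app r b y = Some (f b)"
  shows "cont1 D f"
proof -
  define h where "h b = the (cantor_app r b)" for b
  have h: "cantor_app r b = Some (h b)" "cantor_app (h b) y = Some (f b)" if "b \<in> D" for b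
    using assms[OF that] by (auto simp: bind_eq_Some_conv h_def)
  have h': "cont1 D h" by (rule cont1_app) (rule h(1))
  show ?thesis
    unfolding cont1_iff_agree
  proof (intro ballI allI)
    fix a n assume a: "a \<in> D"
    from cantor_app_cont[OF h(2)[OF a]] obtain m where
      m: "\<And>\<alpha>' \<beta>' \<gamma>'. cantor_app \<alpha>' \<beta>' = Some \<gamma>' \<Longrightarrow> agree m (h a) \<alpha>' \<Longrightarrow> agree m y \<beta>' \<Longrightarrow> agree n (f a) \<gamma>'"
      by blast
    obtain k where "\<And>a'. a' \<in> D \<Longrightarrow> agree k a a' \<Longrightarrow> agree m (h a) (h a')"
      using h' a unfolding cont1_iff_agree by blast
    then show "\<exists>k. \<forall>a'\<in>D. agree k a a' \<longrightarrow> agree n (f a) (f a')"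
      using m[OF h(2) _ agree_refl] by blast
  qed
qed

text \<open>The coding is arbitrary, so continuity must come from representability of appending. As
  appending works at the end while \<open>b\<close> stands at the head, the list is grown from
  \<open>[b]\<close> by the entries of \<open>ys\<close>.\<close>

lemma cont1_seq_Cons:
  assumes "pca_coding cantor_app tt ff pair num seq"
  shows "cont1 UNIV (\<lambda>b. seq (b # ys))"
proof -
  interpret pca_coding cantor_app tt ff pair num seq by (fact assms)
  obtain r where r: "\<And>xs x. app2 cantor_app r (seq xs) x = Some (seq (xs @ [x]))"
    using seq_append by blast
  show ?thesis
  proof (induction ys rule: rev_induct)
    case Nil
    have "cantor_app (the (cantor_app r (seq []))) x = Some (seq [x])" for x
      using r[of "[]" x] by (auto simp: bind_eq_Some_conv)
    then show ?case by (rule cont1_app)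
  next
    case (snoc y ys)
    \<comment> \<open>The appending element is only known to be defined on codes of sequences, hence
      this domain.\<close>
    have "cont1 (range seq) (\<lambda>s. the (app2 cantor_app r s y))"
      by (rule cont1_app2[where r = r and y = y]) (auto simp: r simp del: Option.bind_assoc)
    from cont1_comp[OF snoc this] have "cont1 UNIV (\<lambda>b. the (app2 cantor_app r (seq (b # ys)) y))"
      by blast
    then show ?case
      unfolding r by simp
  qed
qed

lemma Eq_infty_not_representable:
  assumes coding: "pca_coding cantor_app tt ff cantor_pair num seq" and F: "countable (range F)"
  shows "\<not> representable (oracle_app cantor_app tt ff cantor_pair seq (\<lambda>C. Some (F C)))
           (\<lambda>C. Some (Eq_infty C))"
proof
  interpret pca_coding cantor_app tt ff cantor_pair num seq by (fact coding)
  assume "representable (oracle_app cantor_app tt ff cantor_pair seq (\<lambda>C. Some (F C)))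
           (\<lambda>C. Some (Eq_infty C))"
  then obtain r where r: "\<And>b. oracle_computes cantor_app tt ff cantor_pair seq (\<lambda>C. Some (F C)) r b (Eq_infty b)"
    unfolding representable_def oracle_app_eq_Some_iff by blast
  define V where "V ys = {b. cantor_app r (seq (b # ys)) = Some (cantor_pair tt (Eq_infty b))}" for ys
  have V: "cont1 (V ys) Eq_infty" for ys
  proof -
    have seq: "cont1 (V ys) (\<lambda>b. seq (b # ys))"
      using cont1_seq_Cons[OF coding, of ys] unfolding cont1_def by blast
    have "cont1 ((\<lambda>b. seq (b # ys)) ` V ys) (\<lambda>s. the (cantor_app r s))"
      by (rule cont1_app[where r = r]) (auto simp: V_def)
    from cont1_comp[OF seq this]
    have "cont1 (V ys) (\<lambda>b. the (cantor_app r (seq (b # ys))))"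
      by simp
    moreover have "cont1 UNIV cantor_snd"
      by (rule cont1I[where h = "\<lambda>n. 2 * n + 2"]) (auto simp: agree_def cantor_snd_def)
    ultimately have "cont1 (V ys) (\<lambda>b. cantor_snd (the (cantor_app r (seq (b # ys)))))"
      by (rule cont1_comp) simp
    then show ?thesis
      by (auto simp: cont1_def V_def)
  qed
  let ?L = "lists (range F)"
  have L: "countable ?L" "?L \<noteq> {}"
    using F by (auto intro: countable_lists)
  have "b \<in> (\<Union>ys\<in>?L. V ys)" for b
  proof -
    obtain es ys where ys: "list_all2 (\<lambda>e y. Some (F e) = Some y) es ys"
      "cantor_app r (seq (b # ys)) = Some (cantor_pair tt (Eq_infty b))"
      using r[of b] unfolding oracle_computes_def by blast
    have "ys = map F es"
      using ys(1) by (induction rule: list_all2_induct) auto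
    then have "ys \<in> ?L" by auto
    then show ?thesis using ys(2) by (auto simp: V_def)
  qed
  then have "(\<Union>ys\<in>?L. V ys) = UNIV" by blast
  then have "(\<Union>i. V (from_nat_into ?L i)) = UNIV"
    using range_from_nat_into[OF L(2,1)] by (metis image_image)
  with Eq_infty_not_sigma_continuous[OF V] show False by blast
qed

theorem theorem3p4:
  shows "\<not> (\<exists>V :: nat \<Rightarrow> cantor set. (\<Union>i. V i) = UNIV \<and> (\<forall>i. continuous_on (V i) Eq_infty)) \<and>
    (\<forall>(tt :: cantor) ff num seq (F :: cantor \<Rightarrow> cantor).
       pca_coding cantor_app tt ff cantor_pair num seq \<longrightarrow> countable (range F) \<longrightarrow>
       \<not> representable (oracle_app cantor_app tt ff cantor_pair seq (\<lambda>C. Some (F C)))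
           (\<lambda>C. Some (Eq_infty C)))"
  using Eq_infty_not_sigma_continuous Eq_infty_not_representable
  unfolding continuous_on_iff_cont1 by blast

end
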